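(* If the capacity of the APs is not limited (i.e. the constraint $\sum_{f\in\mathcal F} r_i^f\le B$ is omitted for every AP $i$), then the followers' game of the multi-leader multi-follower Stackelberg game, in which each AP $i\in\mathcal R$ solves $\widetilde{\mathbf r}_i(\mathbf C)=\arg\max_{\mathbf r_i}V_i(\mathbf r_i,\mathbf r_{-i},\mathbf C)$, can be decomposed into $|\mathcal F|$ followers' games $\big(FG(1),\dots,FG(|\mathcal F|)\big)$.
   Context: $\mathcal F$ is a set of flows (the leaders) and $\mathcal R$ a set of access points, APs (the followers), with $|\mathcal R|=R\ge 2$. Flow $f$ offers a payment $C^f$, and $\mathbf C=(C^1,\dots,C^{|\mathcal F|})$. AP $i$ chooses $\mathbf r_i=(r_i^1,\dots,r_i^{|\mathcal F|})$, where $r_i^f\ge 0$ is the amount of data AP $i$ offloads for flow $f$; $e_i^f$ is the cost for AP $i$ of offloading a packet of flow $f$. The payoff of AP $i$ is $$V_i=\sum_{f\in\mathcal F}V_i^f,\qquad V_i^f=C^f\frac{r_i^f}{\sum_{j\in\mathcal R}r_j^f}-e_i^f r_i^f .$$ $\mathbf r_{-i}$ denotes the strategies of all APs other than $i$, and $\mathbf r^f_{-i}$ the amounts offloaded for flow $f$ by all APs other than $i$. In the followers' game, given $\mathbf C$, each AP $i$ chooses $\mathbf r_i$ to maximize $V_i(\mathbf r_i,\mathbf r_{-i},\mathbf C)$ subject to $r_i^f\ge 0$ and, when capacity is limited, $\sum_{f\in\mathcal F} r_i^f\le B$, where $B$ is the offloading capacity of an AP. For $f\in\mathcal F$, $FG(f)$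 is the game among the APs corresponding to the optimization problems $\widetilde r_i^f(C^f)=\arg\max_{r_i^f}V_i^f(r_i^f,\mathbf r^f_{-i},C^f)$, $i\in\mathcal R$, over $r_i^f\ge 0$. *)

theory Defs
  imports Complex_Main "HOL-Library.Cardinality"
begin

text \<open>Games in strategic form with players \<open>'p\<close> and individual strategies of type \<open>'s\<close>.\<close>

record ('p, 's) game =
  strategies :: "'p \<Rightarrow> 's set"
  payoff :: "'p \<Rightarrow> ('p \<Rightarrow> 's) \<Rightarrow> real"

text \<open>
  The arg max is set-valued: it may be empty or contain several strategies. Only the components
  \<open>\<sigma> j\<close> with \<open>j \<noteq> i\<close> matter, because \<open>\<sigma> i\<close> is overwritten.
\<close>

definition best_responses :: "('p, 's) game \<Rightarrow> 'p \<Rightarrow> ('p \<Rightarrow> 's) \<Rightarrow> 's set" where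
  "best_responses G i \<sigma> =
     {s. is_arg_max (\<lambda>t. payoff G i (\<sigma>(i := t))) (\<lambda>t. t \<in> strategies G i) s}"

definition nash_equilibrium :: "('p, 's) game \<Rightarrow> ('p \<Rightarrow> 's) \<Rightarrow> bool" where
  "nash_equilibrium G \<sigma> \<longleftrightarrow> (\<forall>i. \<sigma> i \<in> best_responses G i \<sigma>)"

text \<open>
  A game whose strategies are families indexed by \<open>'f\<close> decomposes into games \<open>H f\<close> with the same
  players if strategies and payoffs split along \<open>'f\<close> and if solving the game, both as the
  optimization problem of each single player and as an equilibrium problem, amounts to solving
  each \<open>H f\<close> separately.
\<close>

definition decomposes_into ::
    "('p, 'f::finite \<Rightarrow> 's) game \<Rightarrow> ('f \<Rightarrow> ('p, 's) game) \<Rightarrow> bool" where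
  "decomposes_into G H \<longleftrightarrow>
     (\<forall>i. strategies G i = {s. \<forall>f. s f \<in> strategies (H f) i}) \<and>
     (\<forall>i \<sigma>. (\<forall>j. \<sigma> j \<in> strategies G j) \<longrightarrow>
        payoff G i \<sigma> = (\<Sum>f\<in>UNIV. payoff (H f) i (\<lambda>j. \<sigma> j f))) \<and>
     (\<forall>i \<sigma>. (\<forall>j. j \<noteq> i \<longrightarrow> \<sigma> j \<in> strategies G j) \<longrightarrow>
        best_responses G i \<sigma> = {s. \<forall>f. s f \<in> best_responses (H f) i (\<lambda>j. \<sigma> j f)}) \<and>
     (\<forall>\<sigma>. nash_equilibrium G \<sigma> \<longleftrightarrow> (\<forall>f. nash_equilibrium (H f) (\<lambda>j. \<sigma> j f)))"

text \<open>
  \<open>flow_payoff c \<epsilon> i x\<close> is the payoff of access point \<open>i\<close> from one flow that pays \<open>c\<close>, where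
  \<open>\<epsilon>\<close> is the cost of \<open>i\<close> per packet and \<open>x j\<close> the amount offloaded by \<open>j\<close>. Since
  \<open>0 / 0 = 0\<close> in HOL, no access point is paid for a flow for which nobody offloads.
\<close>

definition flow_payoff :: "real \<Rightarrow> real \<Rightarrow> 'r::finite \<Rightarrow> ('r \<Rightarrow> real) \<Rightarrow> real" where
  "flow_payoff c \<epsilon> i x = c * (x i / (\<Sum>j\<in>UNIV. x j)) - \<epsilon> * x i"

text \<open>
  The capacity is \<open>None\<close> if it is not limited. A profile \<open>r\<close> has the entries \<open>r i f\<close>.
\<close>

definition feasible_offloads :: "real option \<Rightarrow> ('f::finite \<Rightarrow> real) set" where
  "feasible_offloads cap =
     {s. (\<forall>f. 0 \<le> s f) \<and> (case cap of None \<Rightarrow> True | Some B \<Rightarrow> (\<Sum>f\<in>UNIV. s f) \<le> B)}"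

definition followers_game ::
    "real option \<Rightarrow> ('r::finite \<Rightarrow> 'f::finite \<Rightarrow> real) \<Rightarrow> ('f \<Rightarrow> real) \<Rightarrow> ('r, 'f \<Rightarrow> real) game" where
  "followers_game cap e C =
     \<lparr>strategies = (\<lambda>i. feasible_offloads cap),
      payoff = (\<lambda>i r. \<Sum>f\<in>UNIV. flow_payoff (C f) (e i f) i (\<lambda>j. r j f))\<rparr>"

definition FG ::
    "('r::finite \<Rightarrow> 'f \<Rightarrow> real) \<Rightarrow> ('f \<Rightarrow> real) \<Rightarrow> 'f \<Rightarrow> ('r, real) game" where
  "FG e C f =
     \<lparr>strategies = (\<lambda>i. {0..}),
      payoff = (\<lambda>i. flow_payoff (C f) (e i f) i)\<rparr>"

end

theory Submission
  imports Defs
begin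

text \<open>Without a capacity bound, the strategy set of an AP is a product over the flows, and its
  payoff is a sum whose \<open>f\<close>-th term depends only on the amounts for \<open>f\<close>.
  Such a sum is maximal over a product exactly when every term is
  (\<open>is_arg_max_separable_sum\<close>): one coordinate can be varied alone, and conversely the
  termwise inequalities add up. \<open>decomposes_into_if_separable\<close> carries this over to
  games.\<close>

lemma is_arg_max_separable_sum:
  fixes g :: "'f::finite \<Rightarrow> 's \<Rightarrow> real"
  shows "is_arg_max (\<lambda>t. \<Sum>f\<in>UNIV. g f (t f)) (\<lambda>t. \<forall>f. t f \<in> S f) s \<longleftrightarrow>
    (\<forall>f. is_arg_max (g f) (\<lambda>x. x \<in> S f) (s f))"
proof
  assume max: "is_arg_max (\<lambda>t. \<Sum>f\<in>UNIV. g f (t f)) (\<lambda>t. \<forall>f. t f \<in> S f) s"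
  show "\<forall>f. is_arg_max (g f) (\<lambda>x. x \<in> S f) (s f)"
  proof
    fix f
    have "g f x \<le> g f (s f)" if "x \<in> S f" for x
    proof -
      \<comment> \<open>Deviating in the single coordinate \<open>f\<close> leaves all other summands unchanged.\<close>
      let ?t = "s(f := x)"
      have "(\<Sum>h\<in>UNIV. g h (?t h)) \<le> (\<Sum>h\<in>UNIV. g h (s h))"
        using max that by (force simp: is_arg_max_linorder)
      moreover have "(\<Sum>h\<in>UNIV. g h (?t h)) = g f x + (\<Sum>h\<in>UNIV - {f}. g h (s h))"
        by (simp add: sum.remove[of UNIV f])
      moreover have "(\<Sum>h\<in>UNIV. g h (s h)) = g f (s f) + (\<Sum>h\<in>UNIV - {f}. g h (s h))"
        by (simp add: sum.remove[of UNIV f])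
      ultimately show ?thesis by simp
    qed
    with max show "is_arg_max (g f) (\<lambda>x. x \<in> S f) (s f)"
      by (simp add: is_arg_max_linorder)
  qed
next
  assume "\<forall>f. is_arg_max (g f) (\<lambda>x. x \<in> S f) (s f)"
  then show "is_arg_max (\<lambda>t. \<Sum>f\<in>UNIV. g f (t f)) (\<lambda>t. \<forall>f. t f \<in> S f) s"
    by (simp add: is_arg_max_linorder sum_mono)
qed

text \<open>With the strategies of the others fixed, the payoff of a deviation is a separable sum,
  so best responses form a product over the coordinates.\<close>

lemma decomposes_into_if_separable:
  fixes G :: "('p, 'f::finite \<Rightarrow> 's) game"
  assumes strategies: "\<And>i. strategies G i = {s. \<forall>f. s f \<in> strategies (H f) i}"
    and payoff: "\<And>i \<sigma>. payoff G i \<sigma> = (\<Sum>f\<in>UNIV. payoff (H f) i (\<lambda>j. \<sigma> j f))"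
  shows "decomposes_into G H"
proof -
  \<comment> \<open>Restricted to \<open>f\<close>, a deviation of \<open>i\<close> in
    \<open>G\<close> is a deviation of \<open>i\<close> in \<open>H f\<close>, so the
    \<open>f\<close>-th term depends on \<open>t\<close> only through \<open>t f\<close>.\<close>
  have upd: "(\<lambda>j. (\<sigma>(i := t)) j f) = (\<lambda>j. \<sigma> j f)(i := t f)"
    for \<sigma> :: "'p \<Rightarrow> 'f \<Rightarrow> 's" and i t f
    by auto
  have best: "best_responses G i \<sigma> = {s. \<forall>f. s f \<in> best_responses (H f) i (\<lambda>j. \<sigma> j f)}" for i \<sigma>
    unfolding best_responses_def strategies payoff upd mem_Collect_eq
    by (intro Collect_cong
        is_arg_max_separable_sum[where g = "\<lambda>f x. payoff (H f) i ((\<lambda>j. \<sigma> j f)(i := x))"])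
  have "nash_equilibrium G \<sigma> \<longleftrightarrow> (\<forall>f. nash_equilibrium (H f) (\<lambda>j. \<sigma> j f))" for \<sigma>
    \<comment> \<open>Only the quantifiers over players and coordinates are exchanged.\<close>
    unfolding nash_equilibrium_def best by blast
  with strategies payoff best show ?thesis
    unfolding decomposes_into_def by blast
qed

theorem mainTheorem1:
  fixes e :: "'r::finite \<Rightarrow> 'f::finite \<Rightarrow> real"
    and C :: "'f \<Rightarrow> real"
    and cap :: "real option"
  assumes "CARD('r) \<ge> 2"
    and unlimited: "cap = None"
  shows "decomposes_into (followers_game cap e C) (FG e C)"
  \<comment> \<open>For \<open>cap = None\<close> the feasible set is a product of half-lines; a
    bound on the sum would couple the flows.\<close>
  by (rule decomposes_into_if_separable)
    (simp_all add: followers_game_def FG_def feasible_offloads_def unlimited)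

end
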